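(* Let $G$ be a semigraph, $G^S$ its graph skeleton, $r$ the rank of $G$ (the number of vertices in its largest edge), $\Delta^S$ the maximum degree of the graph $G^S$, and $\lambda_1$ the largest eigenvalue of the adjacency matrix of $G$. Then $$\lambda_1\le \frac{r(r-1)}{2}\,\Delta^S .$$ Also, if $\delta$ is the minimum degree of $G$, then $\delta\le\lambda_1$.
   Context: A semigraph is a pair $G=(V,E)$, where $V$ is a non-empty finite set (vertices) and $E$ is a set of ordered $k$-tuples ($k\ge 2$, $k$ may vary) of distinct vertices (edges), such that any two distinct edges have at most one vertex in common; an edge $(u_1,\dots,u_k)$ is identified with its reversal $(u_k,\dots,u_1)$. Standing assumption: semigraphs are connected, i.e. for any two vertices $u,v$ there is a sequence of edges $e_{i_1},\dots,e_{i_p}$ with $u\in e_{i_1}$, $v\in e_{i_p}$ and $|e_{i_j}\cap e_{i_{j+1}}|=1$ for $1\le j\le p-1$. For an edge $(u_1,\dots,u_k)$, $u_1,u_k$ are its end vertices and $u_2,\dots,u_{k-1}$ its middle vertices. A vertex is a pure end vertex if it is an end vertex of every edge containing it; a pure middle vertex if it is a middle vertex of every edge containing it; a middle end vertex if it is a middle vertex of at least one edge and an end vertex of at least one other edge. An edge $(u_1,\dots,u_k)$, $k\ge2$, is a full edge if $u_1,u_k$ are pure end vertices. An edge with $k>2$ is a half edge if at least one of $u_1,u_k$ is a middle end vertex. An edge $(u_1,u_2)$ with two vertices is a quarter edge if both are middle end vertices, and a half edge if exactly one is a middle end vertex and the other is a pure end vertex. For a half edge $(u_1,\dots,u_k)$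 with $k>2$, the pair $(u_1,u_2)$ is a partial half edge if $u_1$ is a middle end vertex, and $(u_{k-1},u_k)$ is a partial half edge if $u_k$ is a middle end vertex; a half edge with two vertices is itself a partial half edge. For vertices $u_i,u_j$ of an edge $e=(u_1,\dots,u_k)$ put $d_e(u_i,u_j)=|i-j|$. The adjacency matrix of a semigraph with vertices $v_1,\dots,v_n$ is the symmetric $n\times n$ matrix $A=(a_{ij})$ with: $a_{ij}=d_e(v_i,v_j)$ if $v_i\neq v_j$ belong to a full edge or half edge $e$ and $(v_i,v_j)$ is neither a partial half edge nor a quarter edge; $a_{ij}=\frac12$ if $(v_i,v_j)$ is a partial half edge; $a_{ij}=\frac14$ if $(v_i,v_j)$ is a quarter edge; $a_{ij}=0$ otherwise. The graph skeleton $G^S$ is the graph on $V$ in which two vertices are adjacent iff they are consecutive in some edge of $G$. The degree $d(v_i)$ of a vertex $v_i$ of $G$ is the $i$-th row sum of $A$ (the paper writes it as $d^S(v_i)+d^E(v_i)$, the row sums of $A^S$ and of $A^E=A-A^S$, where $A^S$ is the adjacency matrix of $G^S$); the minimum degree of $G$ is $\min_i d(v_i)$. *)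

theory Defs
  imports "Jordan_Normal_Form.Spectral_Radius"
begin

(* An edge is a list.  Since an edge is identified with its reversal and two distinct edges share
   at most one vertex, E contains exactly one of the two orientations of every edge: having both
   e and rev e in E would violate at_most_one_common.  All notions below are invariant under
   replacing an edge by its reversal. *)
locale semigraph =
  fixes V :: "'a set" and E :: "'a list set"
  assumes finite_V: "finite V"
    and V_nonempty: "V \<noteq> {}"
    and edge_vertices: "e \<in> E \<Longrightarrow> set e \<subseteq> V"
    and edge_length: "e \<in> E \<Longrightarrow> 2 \<le> length e"
    and edge_distinct: "e \<in> E \<Longrightarrow> distinct e"
    and at_most_one_common: "e \<in> E \<Longrightarrow> f \<in> E \<Longrightarrow> e \<noteq> f \<Longrightarrow> card (set e \<inter> set f) \<le> 1"

definition edge_walk :: "'a list set \<Rightarrow> 'a list list \<Rightarrow> bool" where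
  "edge_walk E es \<longleftrightarrow> es \<noteq> [] \<and> set es \<subseteq> E \<and>
     (\<forall>j. Suc j < length es \<longrightarrow> card (set (es ! j) \<inter> set (es ! Suc j)) = 1)"

(* "Any two vertices" means two different ones, so a single vertex without edges is connected. *)
locale connected_semigraph = semigraph +
  assumes connected: "u \<in> V \<Longrightarrow> v \<in> V \<Longrightarrow> u \<noteq> v \<Longrightarrow>
     \<exists>es. edge_walk E es \<and> u \<in> set (hd es) \<and> v \<in> set (last es)"

definition end_of :: "'a list \<Rightarrow> 'a \<Rightarrow> bool" where
  "end_of e v \<longleftrightarrow> v = hd e \<or> v = last e"

definition middle_of :: "'a list \<Rightarrow> 'a \<Rightarrow> bool" where
  "middle_of e v \<longleftrightarrow> v \<in> set (butlast (tl e))"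

definition pure_end :: "'a list set \<Rightarrow> 'a \<Rightarrow> bool" where
  "pure_end E v \<longleftrightarrow> (\<forall>e\<in>E. v \<in> set e \<longrightarrow> end_of e v)"

definition middle_end :: "'a list set \<Rightarrow> 'a \<Rightarrow> bool" where
  "middle_end E v \<longleftrightarrow> (\<exists>e\<in>E. \<exists>f\<in>E. e \<noteq> f \<and> middle_of e v \<and> end_of f v)"

definition full_edge :: "'a list set \<Rightarrow> 'a list \<Rightarrow> bool" where
  "full_edge E e \<longleftrightarrow> e \<in> E \<and> pure_end E (hd e) \<and> pure_end E (last e)"

definition half_edge :: "'a list set \<Rightarrow> 'a list \<Rightarrow> bool" where
  "half_edge E e \<longleftrightarrow> e \<in> E \<and>
     (length e > 2 \<and> (middle_end E (hd e) \<or> middle_end E (last e)) \<or>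
      length e = 2 \<and> (middle_end E (hd e) \<and> pure_end E (last e) \<or>
                       pure_end E (hd e) \<and> middle_end E (last e)))"

definition quarter_edge :: "'a list set \<Rightarrow> 'a list \<Rightarrow> bool" where
  "quarter_edge E e \<longleftrightarrow> e \<in> E \<and> length e = 2 \<and> middle_end E (hd e) \<and> middle_end E (last e)"

(* Partial half edges and quarter edges are unordered pairs of vertices, so that the adjacency
   matrix is symmetric. *)
definition partial_half_pair :: "'a list set \<Rightarrow> 'a \<Rightarrow> 'a \<Rightarrow> bool" where
  "partial_half_pair E u v \<longleftrightarrow> (\<exists>e. half_edge E e \<and>
     (length e > 2 \<and> middle_end E (hd e) \<and> {u, v} = {e ! 0, e ! 1} \<or>
      length e > 2 \<and> middle_end E (last e) \<and> {u, v} = {e ! (length e - 2), e ! (length e - 1)} \<or>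
      length e = 2 \<and> {u, v} = {e ! 0, e ! 1}))"

definition quarter_pair :: "'a list set \<Rightarrow> 'a \<Rightarrow> 'a \<Rightarrow> bool" where
  "quarter_pair E u v \<longleftrightarrow> (\<exists>e. quarter_edge E e \<and> {u, v} = {e ! 0, e ! 1})"

definition edge_pos :: "'a list \<Rightarrow> 'a \<Rightarrow> nat" where
  "edge_pos e v = (THE i. i < length e \<and> e ! i = v)"

definition edge_dist :: "'a list \<Rightarrow> 'a \<Rightarrow> 'a \<Rightarrow> real" where
  "edge_dist e u v = \<bar>real (edge_pos e u) - real (edge_pos e v)\<bar>"

(* The edge below is unique, because two different edges share at most one vertex. *)
definition common_edge :: "'a list set \<Rightarrow> 'a \<Rightarrow> 'a \<Rightarrow> 'a list" where
  "common_edge E u v = (THE e. e \<in> E \<and> u \<in> set e \<and> v \<in> set e)"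

lemma (in semigraph) common_edge_eq:
  assumes "e \<in> E" "u \<in> set e" "v \<in> set e" "u \<noteq> v"
  shows "common_edge E u v = e"
  unfolding common_edge_def
proof (rule the_equality)
  fix f assume f: "f \<in> E \<and> u \<in> set f \<and> v \<in> set f"
  have "card {u, v} \<le> card (set f \<inter> set e)"
    using f assms by (intro card_mono) auto
  then show "f = e"
    using at_most_one_common[of f e] f assms by fastforce
qed (use assms in simp)

lemma (in semigraph) edge_pos_nth:
  assumes "e \<in> E" "i < length e"
  shows "edge_pos e (e ! i) = i"
  unfolding edge_pos_def
  using assms edge_distinct by (intro the_equality) (auto simp: nth_eq_iff_index_eq)

definition adj_entry :: "'a list set \<Rightarrow> 'a \<Rightarrow> 'a \<Rightarrow> real" where
  "adj_entry E u v =
     (if partial_half_pair E u v then 1 / 2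
      else if quarter_pair E u v then 1 / 4
      else if u \<noteq> v \<and> (\<exists>e. (full_edge E e \<or> half_edge E e) \<and> u \<in> set e \<and> v \<in> set e)
      then edge_dist (common_edge E u v) u v
      else 0)"

(* vs enumerates the vertices as v_1, ..., v_n. *)
definition adj_matrix :: "'a list \<Rightarrow> 'a list set \<Rightarrow> real mat" where
  "adj_matrix vs E = mat (length vs) (length vs) (\<lambda>(i, j). adj_entry E (vs ! i) (vs ! j))"

(* The adjacency matrix is real symmetric, so its real spectrum is its whole spectrum. *)
definition largest_eigenvalue :: "real mat \<Rightarrow> real" where
  "largest_eigenvalue A = Max (spectrum A)"

definition vertex_degree :: "'a list \<Rightarrow> 'a list set \<Rightarrow> nat \<Rightarrow> real" where
  "vertex_degree vs E i = (\<Sum>j<length vs. adj_matrix vs E $$ (i, j))"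

definition min_degree :: "'a list \<Rightarrow> 'a list set \<Rightarrow> real" where
  "min_degree vs E = Min (vertex_degree vs E ` {..<length vs})"

(* Sup on nat is Max for finite nonempty sets; it gives 0 if there are no edges, which connectedness
   only permits for a single vertex. *)
definition semigraph_rank :: "'a list set \<Rightarrow> nat" where
  "semigraph_rank E = Sup (length ` E)"

definition skeleton_adj :: "'a list set \<Rightarrow> 'a \<Rightarrow> 'a \<Rightarrow> bool" where
  "skeleton_adj E u v \<longleftrightarrow> (\<exists>e\<in>E. \<exists>i. Suc i < length e \<and> {u, v} = {e ! i, e ! Suc i})"

definition skeleton_degree :: "'a set \<Rightarrow> 'a list set \<Rightarrow> 'a \<Rightarrow> nat" where
  "skeleton_degree V E v = card {u \<in> V. skeleton_adj E u v}"

definition skeleton_max_degree :: "'a set \<Rightarrow> 'a list set \<Rightarrow> nat" where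
  "skeleton_max_degree V E = Max (skeleton_degree V E ` V)"

end

theory Submission
  imports Defs "HOL-Analysis.Function_Topology"
begin

text \<open>An eigenvalue is at most the largest row sum of absolute values, which is read off at an entry
of the eigenvector of maximal modulus. An edge \<open>e\<close> through \<open>u\<close> contributes at most
\<open>1 + \<dots> + (r - 1)\<close> to the row sum of \<open>u\<close>, and choosing in each such edge a vertex consecutive to
\<open>u\<close> is injective, so there are at most as many edges through \<open>u\<close> as skeleton neighbours of \<open>u\<close>.
For the lower bound, the maximum of the Rayleigh quotient of a real symmetric matrix is an
eigenvalue, and the quotient at the all-ones vector is the average degree.\<close>

section \<open>Maximizing the Rayleigh quotient of a real symmetric matrix\<close>

text \<open>Tychonoff's theorem. Vectors are modelled as functions on all of \<open>nat\<close>,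
  whose topology is the product topology.\<close>

lemma compact_box_product:
  fixes b :: "nat \<Rightarrow> real"
  shows "compact {x. \<forall>i. \<bar>x i\<bar> \<le> b i}"
proof -
  have "compactin (product_topology (\<lambda>i. euclidean) UNIV) (PiE UNIV (\<lambda>i. {- b i..b i}))"
    unfolding compactin_PiE by (simp add: compactin_euclidean_iff)
  moreover have "PiE UNIV (\<lambda>i. {- b i..b i}) = {x. \<forall>i. \<bar>x i\<bar> \<le> b i}"
    by (auto simp: PiE_def Pi_def abs_le_iff minus_le_iff)
  ultimately show ?thesis
    by (simp add: euclidean_product_topology compactin_euclidean_iff)
qed

text \<open>The quadratic form attains its maximum on the compact unit sphere; since it is
  homogeneous of degree 2, the bound extends to all vectors.\<close>

lemma rayleigh_maximizer:
  fixes a :: "nat \<Rightarrow> nat \<Rightarrow> real"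
  assumes "0 < n"
  obtains x \<mu> where "(\<Sum>i<n. (x i)\<^sup>2) = 1"
    and "(\<Sum>i<n. \<Sum>j<n. a i j * x i * x j) = \<mu>"
    and "\<And>y. (\<Sum>i<n. \<Sum>j<n. a i j * y i * y j) \<le> \<mu> * (\<Sum>i<n. (y i)\<^sup>2)"
proof -
  define q where "q x = (\<Sum>i<n. \<Sum>j<n. a i j * x i * x j)" for x :: "nat \<Rightarrow> real"
  define N where "N x = (\<Sum>i<n. (x i)\<^sup>2)" for x :: "nat \<Rightarrow> real"
  \<comment> \<open>\<open>b\<close> pins every coordinate from \<open>n\<close> on to 0, so the box
    is an n-dimensional cube and \<open>S\<close> is the unit sphere in it.\<close>
  define b where "b i = (if i < n then 1 else 0 :: real)" for i
  define S where "S = {x. \<forall>i. \<bar>x i\<bar> \<le> b i} \<inter> {x. N x = 1}"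
  have contN: "continuous_on UNIV N" and contq: "continuous_on UNIV q"
    unfolding N_def q_def by (intro continuous_intros continuous_on_product_coordinates)+
  have inS: "x \<in> S" if "N x = 1" "\<And>i. \<not> i < n \<Longrightarrow> x i = 0" for x
  proof -
    have "\<bar>x i\<bar> \<le> 1" if "i < n" for i
    proof -
      have "(x i)\<^sup>2 \<le> N x" unfolding N_def using that by (intro member_le_sum) auto
      then show ?thesis using \<open>N x = 1\<close> by (simp add: abs_square_le_1)
    qed
    with that show ?thesis by (auto simp: S_def b_def)
  qed
  have "compact S"
    unfolding S_def
    by (intro compact_Int_closed compact_box_product closed_Collect_eq contN continuous_on_const)
  moreover have "(\<lambda>i. if i = 0 then 1 else 0) \<in> S"
    using assms by (intro inS) (auto simp: N_def if_distrib[of "\<lambda>t. t\<^sup>2"] cong: if_cong)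
  moreover have "continuous_on S q" using contq continuous_on_subset by blast
  ultimately obtain x where x: "x \<in> S" "\<And>y. y \<in> S \<Longrightarrow> q y \<le> q x"
    using continuous_attains_sup[of S q] by blast
  have "q y \<le> q x * N y" for y
  proof (cases "N y = 0")
    case True
    then have "y i = 0" if "i < n" for i
      using that by (simp add: N_def sum_nonneg_eq_0_iff)
    with True show ?thesis by (simp add: q_def)
  next
    case False
    have "0 \<le> N y" by (simp add: N_def sum_nonneg)
    with False have pos: "0 < N y" by simp
    define s where "s = sqrt (N y)"
    have s: "s\<^sup>2 = N y" "s \<noteq> 0" using pos by (auto simp: s_def)
    \<comment> \<open>Besides normalizing, \<open>z\<close> is cut off beyond \<open>n\<close>,
      where \<open>y\<close> is arbitrary; neither \<open>q\<close> nor \<open>N\<close> sees those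
      coordinates.\<close>
    define z where "z i = (if i < n then y i / s else 0)" for i
    have "N z = N y / s\<^sup>2" by (simp add: N_def z_def power_divide sum_divide_distrib)
    then have "z \<in> S" using s by (intro inS) (auto simp: z_def)
    moreover have "q z = q y / s\<^sup>2"
      by (simp add: q_def z_def sum_divide_distrib power2_eq_square)
    ultimately have "q y / N y \<le> q x" using x(2) s by metis
    then show ?thesis using pos by (simp add: divide_simps)
  qed
  moreover have "N x = 1" using x(1) by (simp add: S_def)
  ultimately show ?thesis using that[of x "q x"] by (simp add: N_def q_def)
qed

text \<open>For a maximizer \<open>x\<close> with value \<open>\<mu>\<close>, the form
  \<open>F\<close> given by \<open>\<mu>\<close> times the squared norm minus the form of
  \<open>A\<close> is positive semidefinite and vanishes at \<open>x\<close>. By symmetry, a zero of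
  such a form lies in its kernel, which means that \<open>x\<close> is an eigenvector for
  \<open>\<mu>\<close>.\<close>

lemma symmetric_matrix_max_eigenvalue:
  fixes A :: "real mat"
  assumes A: "A \<in> carrier_mat n n" and n: "0 < n"
    and sym: "\<And>i j. i < n \<Longrightarrow> j < n \<Longrightarrow> A $$ (i, j) = A $$ (j, i)"
  obtains \<mu> where "eigenvalue A \<mu>"
    and "\<And>y. (\<Sum>i<n. \<Sum>j<n. A $$ (i, j) * y i * y j) \<le> \<mu> * (\<Sum>i<n. (y i)\<^sup>2)"
proof -
  define B where "B x y = (\<Sum>i<n. \<Sum>j<n. A $$ (i, j) * x i * y j)" for x y :: "nat \<Rightarrow> real"
  define I where "I x y = (\<Sum>i<n. x i * y i)" for x y :: "nat \<Rightarrow> real"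
  obtain x \<mu> where x: "I x x = 1" "B x x = \<mu>" and max: "\<And>y. B y y \<le> \<mu> * I y y"
    by (rule rayleigh_maximizer[OF n, of "\<lambda>i j. A $$ (i, j)"])
      (use that in \<open>simp add: B_def I_def power2_eq_square\<close>)
  \<comment> \<open>Moving from \<open>x\<close> a little against the residual \<open>w\<close> would push \<open>F\<close> below \<open>0\<close> unless \<open>w = 0\<close>.\<close>
  define w where "w i = \<mu> * x i - (\<Sum>j<n. A $$ (i, j) * x j)" for i
  have Bsym: "B x w = B w x"
    unfolding B_def by (subst sum.swap) (auto intro!: sum.cong simp: sym mult_ac)
  have "I w w = (\<Sum>i<n. \<mu> * (w i * x i) - w i * (\<Sum>j<n. A $$ (i, j) * x j))"
    unfolding I_def by (intro sum.cong refl) (subst (2) w_def, simp add: algebra_simps)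
  also have "\<dots> = \<mu> * I w x - B w x"
    unfolding I_def B_def sum_subtractf sum_distrib_left by (simp add: mult_ac)
  finally have Iww: "I w w = \<mu> * I w x - B w x" .
  define F where "F y = \<mu> * I y y - B y y" for y
  have F0: "0 \<le> F y" for y using max[of y] by (simp add: F_def)
  \<comment> \<open>The constant term is \<open>F x = 0\<close>, and the linear coefficient is the
    pairing of \<open>w\<close> with the residual, which is \<open>w\<close> itself.\<close>
  have expand: "F (\<lambda>i. x i - s * w i) = s\<^sup>2 * F w - 2 * s * I w w" for s
  proof -
    have B: "B (\<lambda>i. x i - s * w i) y = B x y - s * B w y"
      "B y (\<lambda>i. x i - s * w i) = B y x - s * B y w" for y
      unfolding B_def left_diff_distrib right_diff_distrib sum_subtractf sum_distrib_left
      by (simp_all add: mult_ac)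
    have I: "I (\<lambda>i. x i - s * w i) y = I x y - s * I w y"
      "I y (\<lambda>i. x i - s * w i) = I y x - s * I y w" for y
      unfolding I_def left_diff_distrib right_diff_distrib sum_subtractf sum_distrib_left
      by (simp_all add: mult_ac)
    have "I x w = I w x" by (simp add: I_def mult.commute)
    then have "F (\<lambda>i. x i - s * w i)
        = \<mu> * I x x - B x x + s\<^sup>2 * F w - 2 * s * (\<mu> * I w x - B w x)"
      unfolding F_def B I Bsym by (simp add: algebra_simps power2_eq_square)
    then show ?thesis using x Iww by simp
  qed
  have "I w w = 0"
  proof (rule ccontr)
    assume ne: "I w w \<noteq> 0"
    define W where "W = I w w"
    have "0 \<le> W" by (simp add: W_def I_def sum_nonneg)
    with ne have W: "0 < W" by (simp add: W_def)
    \<comment> \<open>This choice gives \<open>s * F w = W - s < 2 * W\<close>, so the quadratic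
      term cannot offset the linear one; the \<open>+ 1\<close> keeps the denominator positive when
      \<open>F w = 0\<close>.\<close>
    define s where "s = W / (F w + 1)"
    have s: "0 < s" "s * (F w + 1) = W" using W F0[of w] by (auto simp: s_def)
    have "0 \<le> s * (s * F w - 2 * W)"
      using F0[of "\<lambda>i. x i - s * w i"] expand[of s]
      by (simp add: W_def power2_eq_square algebra_simps)
    then have "2 * W \<le> s * F w" using s(1) by (simp add: zero_le_mult_iff)
    with s W show False by (simp add: algebra_simps)
  qed
  then have w0: "w i = 0" if "i < n" for i
    using that by (simp add: I_def sum_nonneg_eq_0_iff)
  have "\<exists>i<n. x i \<noteq> 0"
  proof (rule ccontr)
    assume "\<not> ?thesis"
    then have "I x x = 0" by (simp add: I_def)
    with x show False by simp
  qed
  then have "eigenvector A (vec n x) \<mu>"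
    using A w0 unfolding eigenvector_def
    by (auto simp: vec_eq_iff scalar_prod_def atLeast0LessThan w_def)
  then have "eigenvalue A \<mu>" by (auto simp: eigenvalue_def)
  with max show ?thesis using that by (auto simp: B_def I_def power2_eq_square)
qed

section \<open>Eigenvalues and absolute row sums\<close>

text \<open>In row \<open>i\<close> of the eigenvalue equation, with
  \<open>\<bar>v $ i\<bar> = m\<close> maximal, the triangle inequality gives
  \<open>\<bar>k\<bar> * m \<le> c * m\<close>; \<open>m\<close> is positive and cancels.\<close>

lemma eigenvalue_le_row_sum:
  fixes A :: "real mat"
  assumes A: "A \<in> carrier_mat n n" and ev: "eigenvalue A k"
    and row: "\<And>i. i < n \<Longrightarrow> (\<Sum>j<n. \<bar>A $$ (i, j)\<bar>) \<le> c"
  shows "\<bar>k\<bar> \<le> c"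
proof -
  obtain v where v: "v \<in> carrier_vec n" "v \<noteq> 0\<^sub>v n" "A *\<^sub>v v = k \<cdot>\<^sub>v v"
    using ev A by (auto simp: eigenvalue_def eigenvector_def)
  then obtain l where l: "l < n" "v $ l \<noteq> 0" by (auto simp: vec_eq_iff)
  define m where "m = Max ((\<lambda>j. \<bar>v $ j\<bar>) ` {..<n})"
  have le: "\<bar>v $ j\<bar> \<le> m" if "j < n" for j
    unfolding m_def using that by (intro Max_ge) auto
  have "m \<in> (\<lambda>j. \<bar>v $ j\<bar>) ` {..<n}"
    unfolding m_def using l by (intro Max_in) auto
  then obtain i where i: "i < n" "m = \<bar>v $ i\<bar>" by auto
  have m: "0 < m" using le[OF l(1)] l(2) by linarith
  have "(A *\<^sub>v v) $ i = (\<Sum>j<n. A $$ (i, j) * v $ j)"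
    using A v(1) i(1) by (simp add: scalar_prod_def atLeast0LessThan)
  then have "k * v $ i = (\<Sum>j<n. A $$ (i, j) * v $ j)"
    using v i(1) by simp
  then have "\<bar>k\<bar> * m = \<bar>\<Sum>j<n. A $$ (i, j) * v $ j\<bar>"
    by (metis abs_mult i(2))
  also have "\<dots> \<le> (\<Sum>j<n. \<bar>A $$ (i, j)\<bar> * m)"
    by (intro order_trans[OF sum_abs] sum_mono) (auto simp: abs_mult le intro!: mult_left_mono)
  also have "\<dots> = (\<Sum>j<n. \<bar>A $$ (i, j)\<bar>) * m" by (simp add: sum_distrib_right)
  also have "\<dots> \<le> c * m" using row[OF i(1)] m by (intro mult_right_mono) auto
  finally show ?thesis using m by simp
qed

section \<open>Distances along an edge\<close>

text \<open>The total distance to all positions of a path is largest from an end, where it is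
  \<open>1 + ... + (k - 1)\<close>. In the induction a new last position adds at most
  \<open>k\<close>, unless it is \<open>i\<close> itself.\<close>

lemma sum_abs_diff_le:
  "i < k \<Longrightarrow> (\<Sum>j<k. \<bar>real i - real j\<bar>) \<le> real k * (real k - 1) / 2"
proof (induction k)
  case (Suc k)
  show ?case
  proof (cases "i < k")
    case True
    then show ?thesis using Suc.IH by (simp add: field_simps)
  next
    case False
    then have "i = k" using Suc.prems by simp
    \<comment> \<open>Seen from the last position, reading backwards turns the distances into
      \<open>1, ..., k\<close>.\<close>
    moreover have "(\<Sum>j<k. \<bar>real k - real j\<bar>) = (\<Sum>j<k. real (Suc j))"
      by (rule sum.reindex_bij_witness[of _ "\<lambda>j. k - 1 - j" "\<lambda>j. k - 1 - j"])
        (auto simp: of_nat_diff)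
    moreover have "(\<Sum>j<m. real (Suc j)) = real m * (real m + 1) / 2" for m
      by (induction m) (auto simp: field_simps)
    ultimately show ?thesis by (simp add: field_simps)
  qed
qed simp

context semigraph
begin

lemma finite_E: "finite E"
  by (rule finite_subset[OF _ finite_subset_distinct[OF finite_V]])
    (use edge_vertices edge_distinct in auto)

lemma edge_length_le_rank:
  assumes "e \<in> E"
  shows "length e \<le> semigraph_rank E"
  unfolding semigraph_rank_def using assms finite_E
  by (intro cSup_upper) (auto intro: bdd_above_finite)

lemma edge_dist_nonneg: "0 \<le> edge_dist e u v"
  by (simp add: edge_dist_def)

lemma edge_dist_nth:
  assumes "e \<in> E" "i < length e" "j < length e"
  shows "edge_dist e (e ! i) (e ! j) = \<bar>real i - real j\<bar>"
  using assms by (simp add: edge_dist_def edge_pos_nth)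

text \<open>This lets the entries 1/2 and 1/4 be dominated by distances as well.\<close>

lemma edge_dist_ge_1:
  assumes "e \<in> E" "u \<in> set e" "v \<in> set e" "u \<noteq> v"
  shows "1 \<le> edge_dist e u v"
proof -
  obtain i j where ij: "i < length e" "j < length e" "u = e ! i" "v = e ! j"
    using assms by (metis in_set_conv_nth)
  with assms have "i \<noteq> j" by auto
  then show ?thesis using ij assms by (auto simp: edge_dist_nth)
qed

lemma sum_edge_dist_le:
  assumes e: "e \<in> E" and u: "u \<in> set e"
  shows "(\<Sum>v\<in>set e. edge_dist e u v)
    \<le> real (semigraph_rank E) * (real (semigraph_rank E) - 1) / 2"
proof -
  let ?k = "length e"
  obtain i where i: "i < ?k" "u = e ! i" using u by (metis in_set_conv_nth)
  have "(\<Sum>v\<in>set e. edge_dist e u v) = (\<Sum>j<?k. edge_dist e u (e ! j))"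
    using bij_betw_nth[OF edge_distinct[OF e] refl refl] by (rule sum.reindex_bij_betw[symmetric])
  also have "\<dots> = (\<Sum>j<?k. \<bar>real i - real j\<bar>)"
    using i e by (intro sum.cong) (auto simp: edge_dist_nth)
  also have "\<dots> \<le> real ?k * (real ?k - 1) / 2" by (rule sum_abs_diff_le[OF i(1)])
  \<comment> \<open>Monotonicity of the product uses that \<open>length e - 1\<close> is
    nonnegative.\<close>
  also have "\<dots> \<le> real (semigraph_rank E) * (real (semigraph_rank E) - 1) / 2"
    using edge_length_le_rank[OF e] edge_length[OF e]
    by (intro divide_right_mono mult_mono) auto
  finally show ?thesis .
qed

section \<open>Edges through a vertex and its skeleton neighbours\<close>

text \<open>The predecessor of \<open>u\<close> in \<open>e\<close> serves, or its successor if
  \<open>u\<close> comes first; the latter exists because edges have at least two vertices.\<close>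

lemma exists_skeleton_neighbour:
  assumes e: "e \<in> E" and u: "u \<in> set e"
  shows "\<exists>w\<in>set e. w \<noteq> u \<and> skeleton_adj E w u"
proof -
  obtain i where i: "i < length e" "u = e ! i" using u by (metis in_set_conv_nth)
  have d: "distinct e" and l: "2 \<le> length e" using e edge_distinct edge_length by auto
  show ?thesis
  proof (cases i)
    case 0
    then have "Suc 0 < length e" "{e ! 1, u} = {e ! 0, e ! Suc 0}" using l i by auto
    moreover have "e ! 1 \<noteq> u" using l i 0 d by (simp add: nth_eq_iff_index_eq)
    ultimately show ?thesis using e unfolding skeleton_adj_def
      by (intro bexI[of _ "e ! 1"]) auto
  next
    case (Suc j)
    then have "Suc j < length e" "{e ! j, u} = {e ! j, e ! Suc j}" using i by auto
    moreover have "e ! j \<noteq> u" using i Suc d by (simp add: nth_eq_iff_index_eq)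
    ultimately show ?thesis using e unfolding skeleton_adj_def
      by (intro bexI[of _ "e ! j"]) auto
  qed
qed

lemma card_edges_le_skeleton_degree: "card {e \<in> E. u \<in> set e} \<le> skeleton_degree V E u"
proof -
  have "\<forall>e\<in>{e \<in> E. u \<in> set e}. \<exists>w. w \<in> set e \<and> w \<noteq> u \<and> skeleton_adj E w u"
    using exists_skeleton_neighbour by blast
  from bchoice[OF this] obtain f where
    f: "\<And>e. e \<in> E \<Longrightarrow> u \<in> set e \<Longrightarrow> f e \<in> set e \<and> f e \<noteq> u \<and> skeleton_adj E (f e) u"
    by blast
  \<comment> \<open>If \<open>f e = f e'\<close>, both edges contain the two different vertices
    \<open>u\<close> and \<open>f e\<close>, so they coincide.\<close>
  have "inj_on f {e \<in> E. u \<in> set e}"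
  proof (rule inj_onI)
    fix e e' assume "e \<in> {e \<in> E. u \<in> set e}" "e' \<in> {e \<in> E. u \<in> set e}" "f e = f e'"
    then show "e = e'" using f common_edge_eq[of _ "f e" u] by (metis mem_Collect_eq)
  qed
  moreover have "f ` {e \<in> E. u \<in> set e} \<subseteq> {w \<in> V. skeleton_adj E w u}"
    using f edge_vertices by blast
  ultimately show ?thesis
    unfolding skeleton_degree_def using finite_V by (intro card_inj_on_le) auto
qed

section \<open>Entries and row sums of the adjacency matrix\<close>

lemma pair_in_edge:
  assumes "partial_half_pair E u v \<or> quarter_pair E u v"
  shows "u \<noteq> v \<and> (\<exists>e\<in>E. u \<in> set e \<and> v \<in> set e)"
proof -
  obtain e i j where e: "e \<in> E" "i < length e" "j < length e" "i \<noteq> j" "{u, v} = {e ! i, e ! j}"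
  proof -
    consider e where "half_edge E e" "{u, v} = {e ! 0, e ! 1}"
      | e where "half_edge E e" "{u, v} = {e ! (length e - 2), e ! (length e - 1)}"
      | e where "quarter_edge E e" "{u, v} = {e ! 0, e ! 1}"
      using assms unfolding partial_half_pair_def quarter_pair_def by blast
    then show ?thesis
    proof cases
      case 1
      then show ?thesis using that[of e 0 1] edge_length[of e] by (auto simp: half_edge_def simp del: length_greater_0_conv)
    \<comment> \<open>The truncated subtractions yield two different positions because
      \<open>length e\<close> is at least 2.\<close>
    next
      case 2
      then show ?thesis
        using that[of e "length e - 2" "length e - 1"] edge_length[of e]
        by (simp add: half_edge_def)
    next
      case 3
      then show ?thesis using that[of e 0 1] by (auto simp: quarter_edge_def simp del: length_greater_0_conv)
    qed
  qed
  then have "e ! i \<noteq> e ! j" using edge_distinct by (simp add: nth_eq_iff_index_eq)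
  with e show ?thesis by (metis doubleton_eq_iff nth_mem)
qed

text \<open>This replaces the distinction between full, half and quarter edges by one alternative,
  which is all that the row sum estimate uses.\<close>

lemma adj_entry_cases:
  obtains "adj_entry E u v = 0"
  | e where "e \<in> E" "u \<in> set e" "v \<in> set e" "0 \<le> adj_entry E u v"
    "adj_entry E u v \<le> edge_dist e u v"
proof (cases "partial_half_pair E u v \<or> quarter_pair E u v")
  case True
  then obtain e where e: "u \<noteq> v" "e \<in> E" "u \<in> set e" "v \<in> set e" using pair_in_edge by blast
  then show ?thesis using that(2)[of e] edge_dist_ge_1[of e u v] True by (auto simp: adj_entry_def)
next
  case no_pair: False
  show ?thesis
  proof (cases "u \<noteq> v \<and> (\<exists>e. (full_edge E e \<or> half_edge E e) \<and> u \<in> set e \<and> v \<in> set e)")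
    case True
    then obtain e where e: "u \<noteq> v" "e \<in> E" "u \<in> set e" "v \<in> set e"
      by (auto simp: full_edge_def half_edge_def)
    have "adj_entry E u v = edge_dist e u v"
      using no_pair True common_edge_eq[of e u v] e by (auto simp: adj_entry_def)
    then show ?thesis using that(2)[of e] e by (simp add: edge_dist_nonneg)
  next
    case False
    then have "adj_entry E u v = 0" using no_pair
      by (simp only: adj_entry_def de_Morgan_disj if_False)
    then show ?thesis by (rule that(1))
  qed
qed

lemma adj_entry_nonneg: "0 \<le> adj_entry E u v"
  by (rule adj_entry_cases[of u v]) auto

lemma adj_entry_sym: "adj_entry E u v = adj_entry E v u"
proof -
  have "partial_half_pair E u v = partial_half_pair E v u" "quarter_pair E u v = quarter_pair E v u"
    by (simp_all add: partial_half_pair_def quarter_pair_def insert_commute)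
  moreover have "common_edge E u v = common_edge E v u"
    by (simp add: common_edge_def conj_commute)
  moreover have "edge_dist e u v = edge_dist e v u" for e
    by (simp add: edge_dist_def abs_minus_commute)
  ultimately show ?thesis unfolding adj_entry_def by (auto simp: conj_commute)
qed

lemma sum_adj_entry_le:
  assumes "u \<in> V"
  shows "(\<Sum>v\<in>V. adj_entry E u v)
    \<le> real (semigraph_rank E) * (real (semigraph_rank E) - 1) / 2 * real (skeleton_max_degree V E)"
proof -
  define c where "c = real (semigraph_rank E) * (real (semigraph_rank E) - 1) / 2"
  define P where "P = {e \<in> E. u \<in> set e}"
  \<comment> \<open>At rank 0 the factor \<open>r - 1\<close> is negative as a real number, but the
    product is 0.\<close>
  have c: "0 \<le> c"
    by (cases "semigraph_rank E") (auto simp: c_def)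
  have finP: "finite P" using finite_E by (simp add: P_def)
  \<comment> \<open>Summing over all edges through \<open>u\<close> avoids choosing one for each
    \<open>v\<close>; the other summands are nonnegative. Swapping the two sums then isolates the
    contribution of each edge.\<close>
  have "adj_entry E u v \<le> (\<Sum>e\<in>P. if v \<in> set e then edge_dist e u v else 0)" for v
  proof (rule adj_entry_cases[of u v])
    assume "adj_entry E u v = 0"
    then show ?thesis by (simp add: sum_nonneg edge_dist_nonneg)
  next
    fix e assume e: "e \<in> E" "u \<in> set e" "v \<in> set e" "adj_entry E u v \<le> edge_dist e u v"
    have "(if v \<in> set e then edge_dist e u v else 0)
        \<le> (\<Sum>e\<in>P. if v \<in> set e then edge_dist e u v else 0)"
      using e finP by (intro member_le_sum) (auto simp: P_def edge_dist_nonneg)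
    with e show ?thesis by simp
  qed
  then have "(\<Sum>v\<in>V. adj_entry E u v)
      \<le> (\<Sum>v\<in>V. \<Sum>e\<in>P. if v \<in> set e then edge_dist e u v else 0)"
    by (rule sum_mono)
  also have "\<dots> = (\<Sum>e\<in>P. \<Sum>v\<in>V. if v \<in> set e then edge_dist e u v else 0)"
    by (rule sum.swap)
  also have "\<dots> = (\<Sum>e\<in>P. \<Sum>v\<in>set e. edge_dist e u v)"
    using edge_vertices finite_V
    by (intro sum.cong refl sum.mono_neutral_cong_right) (auto simp: P_def)
  also have "\<dots> \<le> (\<Sum>e\<in>P. c)"
    unfolding c_def by (intro sum_mono sum_edge_dist_le) (auto simp: P_def)
  also have "\<dots> = c * real (card P)" by simp
  also have "\<dots> \<le> c * real (skeleton_max_degree V E)"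
  proof -
    have "skeleton_degree V E u \<le> skeleton_max_degree V E"
      unfolding skeleton_max_degree_def using finite_V assms by (intro Max_ge) auto
    then have "card P \<le> skeleton_max_degree V E"
      using card_edges_le_skeleton_degree[of u] by (simp add: P_def)
    then show ?thesis using c by (intro mult_left_mono) auto
  qed
  finally show ?thesis by (simp add: c_def)
qed

end

section \<open>Bounds for the largest eigenvalue by rank, skeleton degree and minimum degree\<close>

theorem theorem3p1:
  fixes V :: "'a set" and E :: "'a list set" and vs :: "'a list"
  assumes "connected_semigraph V E"
    and "distinct vs" and "set vs = V"
  shows "largest_eigenvalue (adj_matrix vs E)
           \<le> real (semigraph_rank E) * (real (semigraph_rank E) - 1) / 2 * real (skeleton_max_degree V E)
         \<and> min_degree vs E \<le> largest_eigenvalue (adj_matrix vs E)"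
proof -
  interpret connected_semigraph V E by fact
  define n where "n = length vs"
  define A where "A = adj_matrix vs E"
  define c where
    "c = real (semigraph_rank E) * (real (semigraph_rank E) - 1) / 2 * real (skeleton_max_degree V E)"
  have n: "0 < n" using V_nonempty assms(3) by (auto simp: n_def)
  have A: "A \<in> carrier_mat n n" by (simp add: A_def adj_matrix_def n_def)
  have ent: "A $$ (i, j) = adj_entry E (vs ! i) (vs ! j)" if "i < n" "j < n" for i j
    using that by (simp add: A_def adj_matrix_def n_def)
  have row: "(\<Sum>j<n. \<bar>A $$ (i, j)\<bar>) \<le> c" if "i < n" for i
  proof -
    have "(\<Sum>j<n. \<bar>A $$ (i, j)\<bar>) = (\<Sum>j<n. adj_entry E (vs ! i) (vs ! j))"
      using that by (intro sum.cong) (auto simp: ent adj_entry_nonneg)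
    also have "\<dots> = (\<Sum>v\<in>V. adj_entry E (vs ! i) v)"
      using bij_betw_nth[OF assms(2) _ assms(3)[symmetric], of "{..<n}"]
      by (intro sum.reindex_bij_betw) (simp add: n_def)
    also have "\<dots> \<le> c"
      unfolding c_def using that assms(3) by (intro sum_adj_entry_le) (auto simp: n_def)
    finally show ?thesis .
  qed
  obtain \<mu> where \<mu>: "eigenvalue A \<mu>"
    and max: "\<And>y. (\<Sum>i<n. \<Sum>j<n. A $$ (i, j) * y i * y j) \<le> \<mu> * (\<Sum>i<n. (y i)\<^sup>2)"
  proof (rule symmetric_matrix_max_eigenvalue[OF A n])
    show "A $$ (i, j) = A $$ (j, i)" if "i < n" "j < n" for i j
      using that by (simp add: ent adj_entry_sym)
  qed (use that in blast)
  \<comment> \<open>The \<open>Max\<close> in \<open>largest_eigenvalue\<close> is an actual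
    maximum: the spectrum is finite, and \<open>\<mu>\<close> shows that it is nonempty.\<close>
  have fin: "finite (spectrum A)" by (rule card_finite_spectrum(1)[OF A])
  have mem: "\<mu> \<in> spectrum A" using \<mu> by (simp add: spectrum_def)
  have "largest_eigenvalue A \<in> spectrum A"
    unfolding largest_eigenvalue_def using fin mem by (intro Max_in) auto
  then have "\<bar>largest_eigenvalue A\<bar> \<le> c"
    using eigenvalue_le_row_sum[OF A _ row] by (simp add: spectrum_def)
  moreover have "min_degree vs E \<le> \<mu>"
  proof -
    have "min_degree vs E \<le> (\<Sum>j<n. A $$ (i, j))" if "i < n" for i
      using that unfolding min_degree_def
      by (intro order_trans[OF Min_le, of _ "vertex_degree vs E i"])
        (auto simp: vertex_degree_def A_def n_def)
    then have "(\<Sum>i<n. min_degree vs E) \<le> (\<Sum>i<n. \<Sum>j<n. A $$ (i, j))"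
      by (intro sum_mono) auto
    \<comment> \<open>At the all-ones vector the form is the sum of all entries and the squared norm
      is \<open>n\<close>.\<close>
    also have "\<dots> \<le> \<mu> * real n" using max[of "\<lambda>_. 1"] by simp
    finally have "real n * min_degree vs E \<le> real n * \<mu>" by (simp add: mult.commute)
    then show ?thesis using n by simp
  qed
  moreover have "\<mu> \<le> largest_eigenvalue A"
    unfolding largest_eigenvalue_def using fin mem by (rule Max_ge)
  ultimately show ?thesis unfolding A_def c_def by linarith
qed

end
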